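(* Let $A\in\mathbb{C}^{n\times n}$ be skew-Hermitian, $B\in\mathbb{C}^{n\times m}$, and $\Phi(z)=I-B^*(zI-A)^{-2}B$, with $\lambda_k$, $b_k$, $\delta_k$ as in the context. Suppose $k$ is an index such that $$\frac{\|B\|^2}{\delta_k^2}<\frac{(2-\sqrt2)^2}{2}.$$ Then $\Phi$ has exactly one zero (counted with multiplicity) in the open disk with centre $z_k=-\|b_k\|+i\lambda_k$ and radius $$r_k=\frac{2}{(2-\sqrt2)^2}\,\frac{\|B\|^2}{\delta_k^2}\,\|b_k\|.$$
   Context: Standing setting: $n\ge 2$, $1\le m\le n$; $A\in\mathbb{C}^{n\times n}$ is skew-Hermitian ($A^*=-A$); $B\in\mathbb{C}^{n\times m}$ with $\ker B=\{0\}$; the pair $(A,B)$ is stabilizable (equivalently, since $A$ is skew-Hermitian, controllable). $\|\cdot\|$ is the Euclidean norm of vectors and the induced operator norm of matrices. The eigenvalues of $A$, listed with multiplicity, are $i\lambda_1,\dots,i\lambda_n$ with $\lambda_1\le\dots\le\lambda_n$ real; $v_1,\dots,v_n$ is an orthonormal basis of $\mathbb{C}^n$ with $Av_j=i\lambda_jv_j$; $b_j=B^*v_j$; $\delta_k=\min_{j\ne k}|\lambda_j-\lambda_k|$ (the hypothesis on $k$ includes $\delta_k>0$). A zero of the rational $m\times m$ matrix function $\Phi$ is a point $z\notin\sigma(A)$ with $\det\Phi(z)=0$, its multiplicity being that of the zero of $\det\Phi$. *)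

theory Defs
  imports "HOL-Complex_Analysis.Complex_Analysis"
begin

definition conj_transpose :: "complex ^ 'm ^ 'n \<Rightarrow> complex ^ 'n ^ 'm" where
  "conj_transpose M = (\<chi> i j. cnj (M $ j $ i))"

definition skew_hermitian :: "complex ^ 'n ^ 'n \<Rightarrow> bool" where
  "skew_hermitian A \<longleftrightarrow> conj_transpose A = - A"

(* The library's inner product on complex ^ 'n is the real one, i.e. the real part of this. *)
definition hinner :: "complex ^ 'n \<Rightarrow> complex ^ 'n \<Rightarrow> complex" where
  "hinner x y = (\<Sum>i\<in>UNIV. x $ i * cnj (y $ i))"

definition orthonormal_basis :: "(nat \<Rightarrow> complex ^ 'n) \<Rightarrow> bool" where
  "orthonormal_basis v \<longleftrightarrow>
     (\<forall>i\<in>{1..CARD('n)}. \<forall>j\<in>{1..CARD('n)}. hinner (v i) (v j) = (if i = j then 1 else 0)) \<and>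
     vec.span (v ` {1..CARD('n)}) = UNIV"

definition spectrum :: "complex ^ 'n ^ 'n \<Rightarrow> complex set" where
  "spectrum A = {z. \<exists>x. x \<noteq> 0 \<and> A *v x = z *s x}"

(* Continuous-time stabilizability: some state feedback F makes A + B F Hurwitz. *)
definition stabilizable :: "complex ^ 'n ^ 'n \<Rightarrow> complex ^ 'm ^ 'n \<Rightarrow> bool" where
  "stabilizable A B \<longleftrightarrow>
     (\<exists>F :: complex ^ 'n ^ 'm. \<forall>z \<in> spectrum (A + B ** F). Re z < 0)"

definition op_norm :: "complex ^ 'm ^ 'n \<Rightarrow> real" where
  "op_norm M = onorm ((*v) M)"

(* mat z is z I.  matrix_inv is unspecified at singular matrices, so the value of Phi
   is meaningful only for z outside the spectrum of A. *)
definition Phi :: "complex ^ 'n ^ 'n \<Rightarrow> complex ^ 'm ^ 'n \<Rightarrow> complex \<Rightarrow> complex ^ 'm ^ 'm" where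
  "Phi A B z =
     mat 1 - conj_transpose B ** (matrix_inv (mat z - A) ** matrix_inv (mat z - A)) ** B"

definition Phi_zeros :: "complex ^ 'n ^ 'n \<Rightarrow> complex ^ 'm ^ 'n \<Rightarrow> complex set" where
  "Phi_zeros A B = {z. z \<notin> spectrum A \<and> det (Phi A B z) = 0}"

(* If there are infinitely many zeros in S the sum is 0, so a nonzero value
   implies that their number is finite. *)
definition Phi_zero_count :: "complex ^ 'n ^ 'n \<Rightarrow> complex ^ 'm ^ 'n \<Rightarrow> complex set \<Rightarrow> int" where
  "Phi_zero_count A B S =
     (\<Sum>z \<in> Phi_zeros A B \<inter> S. zorder (\<lambda>w. det (Phi A B w)) z)"

(* Minimum over j \<noteq> k; the index set is nonempty for n \<ge> 2. *)
definition gap :: "nat \<Rightarrow> (nat \<Rightarrow> real) \<Rightarrow> nat \<Rightarrow> real" where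
  "gap n lam k = Min ((\<lambda>j. \<bar>lam j - lam k\<bar>) ` ({1..n} - {k}))"

end

(* Write w = z - i lam_k and beta = |b_k|.  In the eigenbasis, Phi = I - E - w^(-2) b_k b_k^*,
   where E collects the terms with j <> k.  On the disk of radius beta about z_k the distance
   to the other eigenvalues is at least (2 - sqrt 2) delta_k, so |E| <= eta = r_k / (2 beta) < 1/2.
   Solving (I - E) x = b_k, the rank-one determinant formula gives
   w^2 det Phi = det (I - E) (w^2 - b_k^* x), and a Neumann-type estimate gives
   |b_k^* x - beta^2| <= beta^2 eta / (1 - eta).  This is smaller than
   4 eta (1 - eta) beta^2 = r_k (2 beta - r_k) <= |w^2 - beta^2| on the circle of radius r_k,
   so Rouche's theorem compares w^2 - b_k^* x with w^2 - beta^2, which has the simple zero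
   w = -beta in the disk.  Stabilizability enters only through beta > 0. *)
theory Submission
  imports Defs
begin

section \<open>Determinant of a rank-one update of the identity\<close>

lemma det_row_add_scaled:
  fixes a b :: "'a::comm_ring_1 ^ 'n"
  shows "det (\<chi> i. if i = l then a + c *s b else f i) =
    det (\<chi> i. if i = l then a else f i) + c * det (\<chi> i. if i = l then b else f i)"
proof -
  have "det (\<chi> i. if i = l then a + c *s b else f i) =
      det (\<chi> i. if i = l then a else f i) + det (\<chi> i. if i = l then c *s b else f i)"
    by (rule det_row_add)
  also have "det (\<chi> i. if i = l then c *s b else f i) = c * det (\<chi> i. if i = l then b else f i)"
    by (rule det_row_mul)
  finally show ?thesis .
qed

text \<open>The rows in \<open>S\<close> differ from unit rows by multiples of row \<open>j\<close>,
  and row operations remove these multiples. In the induction, splitting row \<open>l\<close> by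
  linearity leaves a determinant with two rows equal to \<open>v\<close>, which vanishes. The base
  case is Cramer's lemma for the identity matrix.\<close>

lemma det_rank_one_row:
  fixes u v :: "'a::field ^ 'n"
  assumes "finite S" "j \<notin> S"
  shows "det (\<chi> i. if i = j then v else if i \<in> S then axis i 1 + u $ i *s v else axis i 1) = v $ j"
  using assms
proof (induction S rule: finite_induct)
  case empty
  have "(\<Sum>i\<in>UNIV. v $ i *s row i (mat 1)) = v"
    by (simp add: vec_eq_iff row_def mat_def if_distrib cong: if_cong)
  then have "(\<chi> i. if i = j then v else axis i 1) =
      (\<chi> i. if i = j then \<Sum>i\<in>UNIV. v $ i *s row i (mat 1) else row i (mat 1))"
    by (auto simp: vec_eq_iff row_def mat_def axis_def)
  then have "det (\<chi> i. if i = j then v else axis i 1) = v $ j"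
    by (simp only: cramer_lemma_transpose) simp
  then show ?case by (simp cong: if_cong)
next
  case (insert l S)
  let ?f = "\<lambda>i. if i = j then v else if i \<in> S then axis i 1 + u $ i *s v else axis i 1"
  have lj: "l \<noteq> j" "j \<noteq> l" and jS: "j \<notin> S" using insert.prems by auto
  have "(\<chi> i. if i = j then v else if i \<in> insert l S then axis i 1 + u $ i *s v else axis i 1) =
      (\<chi> i. if i = l then axis l 1 + u $ l *s v else ?f i)"
    using lj by (simp add: vec_eq_iff)
  moreover have "(\<chi> i. if i = l then axis l 1 else ?f i) = (\<chi> i. ?f i)"
    using lj insert.hyps by (simp add: vec_eq_iff)
  moreover have "det (\<chi> i. if i = l then v else ?f i) = 0"
    using lj by (intro det_identical_rows[of l j]) (auto simp: row_def vec_eq_iff)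
  ultimately show ?case
    using insert.IH[OF jS] by (simp add: det_row_add_scaled)
qed

text \<open>The perturbation is switched on one row at a time. By linearity in row \<open>l\<close>,
  each new row adds \<open>u $ l\<close> times a determinant in which that row is \<open>v\<close>,
  and \<open>det_rank_one_row\<close> evaluates it as \<open>v $ l\<close>.\<close>

lemma det_rank_one_update:
  fixes u v :: "'a::field ^ 'n"
  shows "det (mat 1 + (\<chi> i j. u $ i * v $ j)) = 1 + (\<Sum>i\<in>UNIV. u $ i * v $ i)"
proof -
  have "det (\<chi> i. if i \<in> S then axis i 1 + u $ i *s v else axis i 1) = 1 + (\<Sum>i\<in>S. u $ i * v $ i)"
    if "finite S" for S
    using that
  proof (induction S rule: finite_induct)
    case empty
    have "(\<chi> i. axis i 1) = (mat 1 :: 'a ^ 'n ^ 'n)"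
      by (auto simp: vec_eq_iff mat_def axis_def)
    then show ?case by simp
  next
    case (insert l S)
    let ?f = "\<lambda>i. if i \<in> S then axis i 1 + u $ i *s v else axis i 1"
    have "(\<chi> i. if i \<in> insert l S then axis i 1 + u $ i *s v else axis i 1) =
        (\<chi> i. if i = l then axis l 1 + u $ l *s v else ?f i)"
      by (simp add: vec_eq_iff)
    moreover have "(\<chi> i. if i = l then axis l 1 else ?f i) = (\<chi> i. ?f i)"
      using insert.hyps by (simp add: vec_eq_iff)
    ultimately show ?case
      using insert by (simp add: det_row_add_scaled det_rank_one_row algebra_simps)
  qed
  from this[of UNIV] have "det (\<chi> i. axis i 1 + u $ i *s v) = 1 + (\<Sum>i\<in>UNIV. u $ i * v $ i)"
    by simp
  moreover have "(\<chi> i. axis i 1 + u $ i *s v) = mat 1 + (\<chi> i j. u $ i * v $ j)"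
    by (auto simp: vec_eq_iff mat_def axis_def)
  ultimately show ?thesis by simp
qed

section \<open>Hermitian inner product, adjoint and operator norm\<close>

lemma hinner_diff_left: "hinner (x - y) z = hinner x z - hinner y z"
  by (simp add: hinner_def left_diff_distrib sum_subtractf)

lemma hinner_add_left: "hinner (x + y) z = hinner x z + hinner y z"
  by (simp add: hinner_def distrib_right sum.distrib)

lemma hinner_scale_left: "hinner (c *s x) y = c * hinner x y"
  by (simp add: hinner_def sum_distrib_left mult.assoc)

lemma hinner_sum_left: "hinner (sum f I) y = (\<Sum>i\<in>I. hinner (f i) y)"
  by (induction I rule: infinite_finite_induct) (simp_all add: hinner_add_left, simp_all add: hinner_def)

lemma hinner_commute: "hinner x y = cnj (hinner y x)"
  by (simp add: hinner_def mult.commute)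

lemma hinner_adjoint: "hinner (M *v x) y = hinner x (conj_transpose M *v y)"
proof -
  have "hinner (M *v x) y = (\<Sum>i\<in>UNIV. \<Sum>j\<in>UNIV. M $ i $ j * x $ j * cnj (y $ i))"
    by (simp add: hinner_def matrix_vector_mult_def sum_distrib_right)
  also have "\<dots> = (\<Sum>j\<in>UNIV. \<Sum>i\<in>UNIV. M $ i $ j * x $ j * cnj (y $ i))"
    by (rule sum.swap)
  also have "\<dots> = hinner x (conj_transpose M *v y)"
    by (simp add: hinner_def matrix_vector_mult_def conj_transpose_def sum_distrib_left mult_ac)
  finally show ?thesis .
qed

lemma hinner_self: "hinner x x = complex_of_real ((norm x)\<^sup>2)"
proof -
  have "hinner x x = (\<Sum>i\<in>UNIV. complex_of_real ((cmod (x $ i))\<^sup>2))"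
    by (simp only: hinner_def complex_norm_square)
  also have "\<dots> = complex_of_real ((norm x)\<^sup>2)"
    by (simp add: norm_vec_def L2_set_def sum_nonneg)
  finally show ?thesis .
qed

lemma norm_hinner_le: "cmod (hinner x y) \<le> norm x * norm y"
proof -
  have "cmod (hinner x y) \<le> (\<Sum>i\<in>UNIV. \<bar>cmod (x $ i)\<bar> * \<bar>cmod (y $ i)\<bar>)"
    unfolding hinner_def by (rule order_trans[OF norm_sum]) (simp add: norm_mult)
  also have "\<dots> \<le> norm x * norm y"
    unfolding norm_vec_def by (rule L2_set_mult_ineq)
  finally show ?thesis .
qed

lemma norm_le_op_norm: "norm (M *v x) \<le> op_norm M * norm x"
  for M :: "complex ^ 'm ^ 'n"
  unfolding op_norm_def by (rule onorm[OF matrix_vector_mul_bounded_linear])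

lemma op_norm_nonneg: "0 \<le> op_norm M"
  for M :: "complex ^ 'm ^ 'n"
  unfolding op_norm_def by (rule onorm_pos_le[OF matrix_vector_mul_bounded_linear])

text \<open>Testing \<open>M\<close> on \<open>?b\<close>, the image of \<open>y\<close> under the
  adjoint, bounds the square of its norm by \<open>op_norm M * norm ?b * norm y\<close>. One factor
  \<open>norm ?b\<close> cancels, so the case where it is zero is treated apart.\<close>

lemma norm_conj_transpose_le: "norm (conj_transpose M *v y) \<le> op_norm M * norm y"
proof (cases "conj_transpose M *v y = 0")
  case False
  let ?b = "conj_transpose M *v y"
  have "(norm ?b)\<^sup>2 = cmod (hinner (M *v ?b) y)"
    by (simp add: hinner_adjoint hinner_self del: of_real_power)
  also have "\<dots> \<le> norm (M *v ?b) * norm y"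
    by (rule norm_hinner_le)
  also have "\<dots> \<le> (op_norm M * norm ?b) * norm y"
    by (intro mult_right_mono norm_le_op_norm) simp
  finally have "norm ?b * norm ?b \<le> (op_norm M * norm y) * norm ?b"
    by (simp add: power2_eq_square mult_ac)
  then show ?thesis
    using False by (metis mult_le_cancel_right norm_le_zero_iff not_less)
qed (simp add: op_norm_nonneg)

section \<open>Weighted sums of rank-one matrices and orthonormal expansions\<close>

text \<open>One notation serves two purposes: with the orthonormal eigenvectors as \<open>b\<close>
  it is the spectral form of a function of \<open>A\<close>, and with their images under the adjoint
  of \<open>B\<close> it gives the terms of \<open>Phi\<close>.\<close>

definition rank_one_sum :: "nat set \<Rightarrow> (nat \<Rightarrow> complex) \<Rightarrow> (nat \<Rightarrow> complex ^ 'n) \<Rightarrow> complex ^ 'n ^ 'n"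
  where "rank_one_sum I c b = (\<chi> p q. \<Sum>j\<in>I. c j * b j $ p * cnj (b j $ q))"

lemma rank_one_sum_mult_vec:
  "rank_one_sum I c b *v x = (\<Sum>j\<in>I. (c j * hinner x (b j)) *s b j)"
proof -
  have "(rank_one_sum I c b *v x) $ p = (\<Sum>j\<in>I. (c j * hinner x (b j)) * b j $ p)" for p
  proof -
    have "(rank_one_sum I c b *v x) $ p = (\<Sum>q\<in>UNIV. \<Sum>j\<in>I. c j * b j $ p * cnj (b j $ q) * x $ q)"
      by (simp add: rank_one_sum_def matrix_vector_mult_def sum_distrib_right)
    also have "\<dots> = (\<Sum>j\<in>I. \<Sum>q\<in>UNIV. c j * b j $ p * cnj (b j $ q) * x $ q)"
      by (rule sum.swap)
    also have "\<dots> = (\<Sum>j\<in>I. (c j * hinner x (b j)) * b j $ p)"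
      by (simp add: hinner_def sum_distrib_left sum_distrib_right mult_ac)
    finally show ?thesis .
  qed
  then show ?thesis by (simp add: vec_eq_iff)
qed

lemma matrix_vector_mult_sum_scaled:
  fixes M :: "'a::field ^ 'm ^ 'n"
  shows "M *v (\<Sum>j\<in>I. c j *s x j) = (\<Sum>j\<in>I. c j *s (M *v x j))"
  by (simp add: vec.linear_sum[OF matrix_vector_mul_linear_gen]
      vec.linear_scale[OF matrix_vector_mul_linear_gen])

lemma orthonormal_basis_hinner:
  fixes v :: "nat \<Rightarrow> complex ^ 'n"
  assumes "orthonormal_basis v" "i \<in> {1..CARD('n)}" "j \<in> {1..CARD('n)}"
  shows "hinner (v i) (v j) = (if i = j then 1 else 0)"
  using assms by (auto simp: orthonormal_basis_def)

text \<open>The vectors equal to their own expansion form a subspace that contains every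
  \<open>v i\<close>, and the \<open>v i\<close> span the space.\<close>

lemma orthonormal_basis_expansion:
  fixes v :: "nat \<Rightarrow> complex ^ 'n"
  assumes "orthonormal_basis v"
  shows "(\<Sum>j\<in>{1..CARD('n)}. hinner x (v j) *s v j) = x"
proof -
  let ?P = "\<lambda>x. (\<Sum>j\<in>{1..CARD('n)}. hinner x (v j) *s v j) = x"
  have "x \<in> vec.span (v ` {1..CARD('n)})"
    using assms by (simp add: orthonormal_basis_def)
  then show ?thesis
  proof (rule vec.span_induct)
    show "vec.subspace (Collect ?P)"
    proof (rule vec.subspaceI)
      show "0 \<in> Collect ?P" by (simp add: hinner_def)
    next
      fix x y assume "x \<in> Collect ?P" "y \<in> Collect ?P"
      then show "x + y \<in> Collect ?P"
        by (simp add: hinner_add_left vec.scale_left_distrib sum.distrib)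
    next
      fix c x assume "x \<in> Collect ?P"
      then show "c *s x \<in> Collect ?P"
        by (simp add: hinner_scale_left vec.scale_scale[symmetric] vec.scale_sum_right[symmetric]
            del: vector_smult_assoc vec.scale_scale)
    qed
  next
    fix x assume "x \<in> v ` {1..CARD('n)}"
    then obtain i where i: "i \<in> {1..CARD('n)}" "x = v i" by auto
    have "(\<Sum>j\<in>{1..CARD('n)}. hinner x (v j) *s v j) =
        (\<Sum>j\<in>{1..CARD('n)}. if j = i then v i else 0)"
      using i orthonormal_basis_hinner[OF assms i(1)] by (intro sum.cong) auto
    also have "\<dots> = x" using i by simp
    finally show "?P x" .
  qed
qed

lemma parseval:
  fixes v :: "nat \<Rightarrow> complex ^ 'n"
  assumes "orthonormal_basis v"
  shows "L2_set (\<lambda>j. cmod (hinner x (v j))) {1..CARD('n)} = norm x"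
proof -
  have "complex_of_real ((norm x)\<^sup>2) = hinner (\<Sum>j\<in>{1..CARD('n)}. hinner x (v j) *s v j) x"
    by (simp only: orthonormal_basis_expansion[OF assms] hinner_self)
  also have "\<dots> = (\<Sum>j\<in>{1..CARD('n)}. hinner x (v j) * cnj (hinner x (v j)))"
    by (simp add: hinner_sum_left hinner_scale_left hinner_commute[symmetric])
  also have "\<dots> = complex_of_real (\<Sum>j\<in>{1..CARD('n)}. (cmod (hinner x (v j)))\<^sup>2)"
    by (simp only: complex_norm_square of_real_sum)
  finally have "(\<Sum>j\<in>{1..CARD('n)}. (cmod (hinner x (v j)))\<^sup>2) = (norm x)\<^sup>2"
    by (simp only: of_real_eq_iff)
  then show ?thesis by (simp add: L2_set_def)
qed

text \<open>With \<open>y\<close> the image of \<open>x\<close>, the square of \<open>norm y\<close>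
  is a sum over \<open>j\<close> to which Cauchy-Schwarz applies. Since the inner product of
  \<open>w\<close> with the \<open>j\<close>-th vector is that of \<open>B *v w\<close> with
  \<open>v j\<close>, Parseval bounds each factor by \<open>op_norm B\<close> times a norm. A
  triangle inequality over the rank-one terms would instead produce the sum of their norms.\<close>

lemma norm_rank_one_sum_mult_le:
  fixes v :: "nat \<Rightarrow> complex ^ 'n" and B :: "complex ^ 'm ^ 'n"
  assumes v: "orthonormal_basis v" and I: "I \<subseteq> {1..CARD('n)}"
    and c: "\<And>j. j \<in> I \<Longrightarrow> cmod (c j) \<le> K" and K: "0 \<le> K"
  shows "norm (rank_one_sum I c (\<lambda>j. conj_transpose B *v v j) *v x) \<le> K * (op_norm B)\<^sup>2 * norm x"
proof -
  let ?b = "\<lambda>j. conj_transpose B *v v j"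
  define y where "y = rank_one_sum I c ?b *v x"
  have L2: "L2_set (\<lambda>j. cmod (hinner w (?b j))) I \<le> op_norm B * norm w" for w
  proof -
    have "L2_set (\<lambda>j. cmod (hinner w (?b j))) I \<le> L2_set (\<lambda>j. cmod (hinner w (?b j))) {1..CARD('n)}"
      unfolding L2_set_def using I by (intro real_sqrt_le_mono sum_mono2) auto
    also have "\<dots> = norm (B *v w)"
      using parseval[OF v, of "B *v w"] by (simp add: hinner_adjoint)
    finally show ?thesis using norm_le_op_norm[of B w] by linarith
  qed
  have "norm y * norm y = cmod (hinner y y)"
    by (simp only: hinner_self norm_of_real) (simp add: power2_eq_square)
  also have "hinner y y = (\<Sum>j\<in>I. c j * hinner x (?b j) * hinner (?b j) y)"
    by (simp add: y_def rank_one_sum_mult_vec hinner_sum_left hinner_scale_left)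
  also have "cmod \<dots> \<le> (\<Sum>j\<in>I. K * (\<bar>cmod (hinner x (?b j))\<bar> * \<bar>cmod (hinner y (?b j))\<bar>))"
  proof (rule order_trans[OF norm_sum sum_mono])
    fix j assume "j \<in> I"
    have "cmod (hinner (?b j) y) = cmod (hinner y (?b j))"
      by (subst hinner_commute) simp
    then show "cmod (c j * hinner x (?b j) * hinner (?b j) y)
        \<le> K * (\<bar>cmod (hinner x (?b j))\<bar> * \<bar>cmod (hinner y (?b j))\<bar>)"
      using c[OF \<open>j \<in> I\<close>] by (simp add: norm_mult mult.assoc mult_right_mono)
  qed
  also have "\<dots> = K * (\<Sum>j\<in>I. \<bar>cmod (hinner x (?b j))\<bar> * \<bar>cmod (hinner y (?b j))\<bar>)"
    by (simp add: sum_distrib_left)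
  also have "\<dots> \<le> K * (L2_set (\<lambda>j. cmod (hinner x (?b j))) I * L2_set (\<lambda>j. cmod (hinner y (?b j))) I)"
    using K by (intro mult_left_mono L2_set_mult_ineq)
  also have "\<dots> \<le> K * ((op_norm B * norm x) * (op_norm B * norm y))"
    using K by (intro mult_left_mono mult_mono L2 L2_set_nonneg) (simp_all add: op_norm_nonneg)
  finally have "norm y * norm y \<le> (K * (op_norm B)\<^sup>2 * norm x) * norm y"
    by (simp add: power2_eq_square mult_ac)
  then have "norm y \<le> K * (op_norm B)\<^sup>2 * norm x"
    using K by (cases "y = 0") (auto simp: mult_le_cancel_right)
  then show ?thesis by (simp add: y_def)
qed

section \<open>The resolvent and \<open>Phi\<close> in the eigenbasis\<close>

lemma mat_mult_vec: "mat z *v x = z *s x"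
  for x :: "'a::semiring_1 ^ 'n"
  by (simp add: vec_eq_iff matrix_vector_mult_def mat_def if_distrib if_distribR cong: if_cong)

text \<open>\<open>matrix_inv\<close> is defined by choice. The witness \<open>R\<close> shows that
  the chosen matrix is an inverse, and multiplying by \<open>R\<close> identifies it.\<close>

lemma matrix_inv_eqI:
  fixes M R :: "'a::field ^ 'n ^ 'n"
  assumes "M ** R = mat 1"
  shows "matrix_inv M = R"
proof -
  have RM: "R ** M = mat 1" using assms by (simp add: matrix_left_right_inverse)
  have "M ** matrix_inv M = mat 1"
    unfolding matrix_inv_def using assms RM by (rule_tac someI2[of _ R]) auto
  then have "R ** (M ** matrix_inv M) = R" by simp
  then show ?thesis by (simp add: matrix_mul_assoc RM)
qed

text \<open>Applying \<open>mat z - A\<close> to \<open>v j\<close> produces the factor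
  \<open>z - \<mu> j\<close>, which cancels the coefficient and leaves the orthonormal expansion of
  the argument.\<close>

lemma resolvent_rank_one_sum:
  fixes v :: "nat \<Rightarrow> complex ^ 'n"
  assumes v: "orthonormal_basis v"
    and A: "\<And>j. j \<in> {1..CARD('n)} \<Longrightarrow> A *v v j = \<mu> j *s v j"
    and z: "\<And>j. j \<in> {1..CARD('n)} \<Longrightarrow> z \<noteq> \<mu> j"
  shows "(mat z - A) ** rank_one_sum {1..CARD('n)} (\<lambda>j. inverse (z - \<mu> j)) v = mat 1"
proof -
  have "(mat z - A) *v (rank_one_sum {1..CARD('n)} (\<lambda>j. inverse (z - \<mu> j)) v *v x) = x" for x
  proof -
    have "(mat z - A) *v (rank_one_sum {1..CARD('n)} (\<lambda>j. inverse (z - \<mu> j)) v *v x) =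
        (\<Sum>j\<in>{1..CARD('n)}. (inverse (z - \<mu> j) * hinner x (v j)) *s ((mat z - A) *v v j))"
      by (simp only: rank_one_sum_mult_vec matrix_vector_mult_sum_scaled)
    also have "\<dots> = (\<Sum>j\<in>{1..CARD('n)}. hinner x (v j) *s v j)"
    proof (rule sum.cong)
      fix j assume j: "j \<in> {1..CARD('n)}"
      have "(mat z - A) *v v j = (z - \<mu> j) *s v j"
        by (simp add: matrix_vector_mult_diff_rdistrib mat_mult_vec A[OF j] vec.scale_left_diff_distrib)
      then show "(inverse (z - \<mu> j) * hinner x (v j)) *s ((mat z - A) *v v j) = hinner x (v j) *s v j"
        using z[OF j] by (simp only: vector_smult_assoc) simp
    qed simp
    finally show ?thesis by (simp only: orthonormal_basis_expansion[OF v])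
  qed
  then show ?thesis
    by (simp add: matrix_eq matrix_vector_mul_assoc[symmetric])
qed

lemma spectrum_subset_eigenvalues:
  fixes v :: "nat \<Rightarrow> complex ^ 'n"
  assumes v: "orthonormal_basis v"
    and A: "\<And>j. j \<in> {1..CARD('n)} \<Longrightarrow> A *v v j = \<mu> j *s v j"
  shows "spectrum A \<subseteq> \<mu> ` {1..CARD('n)}"
proof (rule subsetI, rule ccontr)
  fix z assume "z \<in> spectrum A" and z: "z \<notin> \<mu> ` {1..CARD('n)}"
  then obtain x where x: "x \<noteq> 0" "A *v x = z *s x" by (auto simp: spectrum_def)
  have "(mat z - A) ** rank_one_sum {1..CARD('n)} (\<lambda>j. inverse (z - \<mu> j)) v = mat 1"
    using z by (intro resolvent_rank_one_sum[OF v A]) auto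
  then obtain R where "R ** (mat z - A) = mat 1"
    using matrix_left_right_inverse by blast
  moreover have "(mat z - A) *v x = 0"
    by (simp add: matrix_vector_mult_diff_rdistrib mat_mult_vec x)
  ultimately show False
    using x(1) by (metis matrix_vector_mul_assoc matrix_vector_mul_lid matrix_vector_mult_0_right)
qed

text \<open>The resolvent is diagonal in the basis \<open>v\<close>, so its square has the squared
  coefficients. The outer factors \<open>conj_transpose B\<close> and \<open>B\<close> then turn
  each \<open>v j\<close> into its image under the adjoint.\<close>

lemma Phi_rank_one_sum:
  fixes v :: "nat \<Rightarrow> complex ^ 'n" and B :: "complex ^ 'm ^ 'n"
  assumes v: "orthonormal_basis v"
    and A: "\<And>j. j \<in> {1..CARD('n)} \<Longrightarrow> A *v v j = \<mu> j *s v j"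
    and z: "\<And>j. j \<in> {1..CARD('n)} \<Longrightarrow> z \<noteq> \<mu> j"
  shows "Phi A B z = mat 1 - rank_one_sum {1..CARD('n)} (\<lambda>j. inverse ((z - \<mu> j)\<^sup>2)) (\<lambda>j. conj_transpose B *v v j)"
proof -
  let ?N = "{1..CARD('n)}"
  let ?R = "rank_one_sum ?N (\<lambda>j. inverse (z - \<mu> j)) v"
  have inv: "matrix_inv (mat z - A) = ?R"
    by (intro matrix_inv_eqI resolvent_rank_one_sum[OF v A z])
  have Rv: "?R *v v j = inverse (z - \<mu> j) *s v j" if "j \<in> ?N" for j
  proof -
    have "?R *v v j = (\<Sum>i\<in>?N. if i = j then inverse (z - \<mu> j) *s v j else 0)"
      unfolding rank_one_sum_mult_vec using orthonormal_basis_hinner[OF v that]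
      by (intro sum.cong) auto
    then show ?thesis using that by simp
  qed
  have "(conj_transpose B ** (?R ** ?R) ** B) *v x =
      rank_one_sum ?N (\<lambda>j. inverse ((z - \<mu> j)\<^sup>2)) (\<lambda>j. conj_transpose B *v v j) *v x" for x
  proof -
    have "(conj_transpose B ** (?R ** ?R) ** B) *v x = conj_transpose B *v (?R *v (?R *v (B *v x)))"
      by (simp add: matrix_vector_mul_assoc matrix_mul_assoc)
    also have "?R *v (B *v x) = (\<Sum>j\<in>?N. (inverse (z - \<mu> j) * hinner (B *v x) (v j)) *s v j)"
      by (rule rank_one_sum_mult_vec)
    also have "?R *v \<dots> = (\<Sum>j\<in>?N. (inverse (z - \<mu> j) * hinner (B *v x) (v j)) *s (?R *v v j))"
      by (rule matrix_vector_mult_sum_scaled)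
    also have "\<dots> = (\<Sum>j\<in>?N. (inverse ((z - \<mu> j)\<^sup>2) * hinner (B *v x) (v j)) *s v j)"
    proof (rule sum.cong)
      fix j assume j: "j \<in> ?N"
      show "(inverse (z - \<mu> j) * hinner (B *v x) (v j)) *s (?R *v v j) =
          (inverse ((z - \<mu> j)\<^sup>2) * hinner (B *v x) (v j)) *s v j"
        by (simp only: Rv[OF j] vector_smult_assoc) (simp add: power2_eq_square mult_ac)
    qed simp
    finally show ?thesis
      by (simp only: matrix_vector_mult_sum_scaled rank_one_sum_mult_vec hinner_adjoint)
  qed
  then have "conj_transpose B ** (?R ** ?R) ** B =
      rank_one_sum ?N (\<lambda>j. inverse ((z - \<mu> j)\<^sup>2)) (\<lambda>j. conj_transpose B *v v j)"
    unfolding matrix_eq by blast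
  then show ?thesis
    by (simp only: Phi_def inv)
qed

text \<open>Because \<open>b k\<close> is the image of \<open>x\<close> under
  \<open>mat 1 - E\<close>, that matrix can be pulled out of the \<open>k\<close>-th term as a left
  factor. What remains is \<open>?U\<close>, a rank-one update of the identity written in the shape
  of \<open>det_rank_one_update\<close>. Multiplying by the square of \<open>z - \<mu> k\<close>
  clears the pole at \<open>\<mu> k\<close>.\<close>

lemma det_Phi_factor:
  fixes v :: "nat \<Rightarrow> complex ^ 'n" and B :: "complex ^ 'm ^ 'n"
  defines "b \<equiv> \<lambda>j. conj_transpose B *v v j"
  assumes v: "orthonormal_basis v"
    and A: "\<And>j. j \<in> {1..CARD('n)} \<Longrightarrow> A *v v j = \<mu> j *s v j"
    and z: "\<And>j. j \<in> {1..CARD('n)} \<Longrightarrow> z \<noteq> \<mu> j" and k: "k \<in> {1..CARD('n)}"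
    and E: "E = rank_one_sum ({1..CARD('n)} - {k}) (\<lambda>j. inverse ((z - \<mu> j)\<^sup>2)) b"
    and x: "(mat 1 - E) *v x = b k"
  shows "(z - \<mu> k)\<^sup>2 * det (Phi A B z) = det (mat 1 - E) * ((z - \<mu> k)\<^sup>2 - hinner x (b k))"
proof -
  let ?c = "inverse ((z - \<mu> k)\<^sup>2)"
  let ?U = "mat 1 + (\<chi> i j. (- ?c *s x) $ i * (\<chi> i. cnj (b k $ i)) $ j) :: complex ^ 'm ^ 'm"
  have U: "?U *v y = y - (?c * hinner y (b k)) *s x" for y
  proof -
    have "(\<chi> i j. (- ?c *s x) $ i * (\<chi> i. cnj (b k $ i)) $ j) *v y = - ((?c * hinner y (b k)) *s x)"
      by (simp add: vec_eq_iff matrix_vector_mult_def hinner_def sum_distrib_left sum_distrib_right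
          sum_negf mult_ac)
    then show ?thesis by (simp add: matrix_vector_mult_add_rdistrib)
  qed
  have Phi: "Phi A B z = mat 1 - rank_one_sum {1..CARD('n)} (\<lambda>j. inverse ((z - \<mu> j)\<^sup>2)) b"
    unfolding b_def using v A z by (rule Phi_rank_one_sum)
  have "Phi A B z *v y = ((mat 1 - E) ** ?U) *v y" for y
  proof -
    have "Phi A B z *v y = y - (\<Sum>j\<in>{1..CARD('n)}. (inverse ((z - \<mu> j)\<^sup>2) * hinner y (b j)) *s b j)"
      by (simp only: Phi matrix_vector_mult_diff_rdistrib rank_one_sum_mult_vec matrix_vector_mul_lid)
    also have "\<dots> = y - (?c * hinner y (b k)) *s b k - E *v y"
      using k by (simp add: sum.remove E rank_one_sum_mult_vec)
    also have "\<dots> = (mat 1 - E) *v y - (?c * hinner y (b k)) *s ((mat 1 - E) *v x)"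
      by (simp only: x) (simp add: matrix_vector_mult_diff_rdistrib)
    also have "\<dots> = (mat 1 - E) *v (?U *v y)"
      by (simp only: U matrix_vector_mult_diff_distrib vec.linear_scale[OF matrix_vector_mul_linear_gen])
    finally show ?thesis by (simp only: matrix_vector_mul_assoc)
  qed
  then have "Phi A B z = (mat 1 - E) ** ?U" by (simp only: matrix_eq) simp
  then have "det (Phi A B z) = det (mat 1 - E) * det ?U" by (simp only: det_mul)
  also have "det ?U = 1 - ?c * hinner x (b k)"
    by (simp only: det_rank_one_update)
      (simp add: hinner_def sum_distrib_left sum_negf mult_ac)
  finally show ?thesis
    using z[OF k] by (simp add: field_simps)
qed

section \<open>Perturbation estimate and positivity from stabilizability\<close>

text \<open>The lower bound \<open>low\<close> makes \<open>mat 1 - E\<close> injective, hence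
  invertible, and bounds the solution \<open>x\<close> by \<open>norm b / (1 - \<eta>)\<close>.
  Since \<open>x = b + E *v x\<close>, the error is exactly \<open>hinner (E *v x) b\<close>, so no
  Neumann series is summed.\<close>

lemma one_minus_contraction:
  fixes E :: "complex ^ 'm ^ 'm"
  assumes E: "\<And>x. norm (E *v x) \<le> \<eta> * norm x" and "0 \<le> \<eta>" "\<eta> < 1"
  shows "det (mat 1 - E) \<noteq> 0"
    and "\<exists>x. (mat 1 - E) *v x = b \<and>
      cmod (hinner x b - of_real ((norm b)\<^sup>2)) \<le> \<eta> / (1 - \<eta>) * (norm b)\<^sup>2"
proof -
  have low: "(1 - \<eta>) * norm x \<le> norm ((mat 1 - E) *v x)" for x
    using E[of x] norm_triangle_ineq2[of x "E *v x"]
    by (simp add: matrix_vector_mult_diff_rdistrib left_diff_distrib)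
  have "x = 0" if "(mat 1 - E) *v x = 0" for x
    using low[of x] that \<open>\<eta> < 1\<close> by (simp add: mult_le_0_iff)
  then obtain R where R: "R ** (mat 1 - E) = mat 1"
    using matrix_left_invertible_ker[of "mat 1 - E"] by blast
  then show "det (mat 1 - E) \<noteq> 0"
    by (metis invertible_det_nz invertible_left_inverse)
  define x where "x = R *v b"
  have "(mat 1 - E) ** R = mat 1"
    using R matrix_left_right_inverse by blast
  then have x: "(mat 1 - E) *v x = b"
    by (simp add: x_def matrix_vector_mul_assoc)
  have "x = b + E *v x" using x by (simp add: matrix_vector_mult_diff_rdistrib algebra_simps)
  then have "hinner x b - of_real ((norm b)\<^sup>2) = hinner (E *v x) b"
    by (metis add_diff_cancel_left' hinner_add_left hinner_self)
  also have "cmod \<dots> \<le> norm (E *v x) * norm b" by (rule norm_hinner_le)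
  also have "\<dots> \<le> (\<eta> * (norm b / (1 - \<eta>))) * norm b"
  proof (intro mult_right_mono order_trans[OF E] mult_left_mono)
    show "norm x \<le> norm b / (1 - \<eta>)"
      using low[of x] x \<open>\<eta> < 1\<close> by (simp add: field_simps)
  qed (use \<open>0 \<le> \<eta>\<close> in auto)
  also have "\<dots> = \<eta> / (1 - \<eta>) * (norm b)\<^sup>2" by (simp add: power2_eq_square)
  finally show "\<exists>x. (mat 1 - E) *v x = b \<and>
      cmod (hinner x b - of_real ((norm b)\<^sup>2)) \<le> \<eta> / (1 - \<eta>) * (norm b)\<^sup>2"
    using x by blast
qed

text \<open>This is one direction of the Hautus test. If the adjoint of \<open>B\<close> kills
  \<open>v\<close>, then for every feedback \<open>F\<close> the vector \<open>v\<close> is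
  orthogonal to the range of \<open>?M\<close>. So \<open>?M\<close> is singular, and the imaginary
  number \<open>?z\<close> stays in the spectrum of the closed loop.\<close>

lemma stabilizable_conj_transpose_eigenvector:
  fixes A :: "complex ^ 'n ^ 'n" and B :: "complex ^ 'm ^ 'n"
  assumes A: "skew_hermitian A" and B: "stabilizable A B"
    and v: "A *v v = (\<i> * complex_of_real l) *s v" "v \<noteq> 0"
  shows "conj_transpose B *v v \<noteq> 0"
proof
  assume Bv: "conj_transpose B *v v = 0"
  obtain F :: "complex ^ 'n ^ 'm" where F: "\<And>z. z \<in> spectrum (A + B ** F) \<Longrightarrow> Re z < 0"
    using B by (auto simp: stabilizable_def)
  let ?z = "\<i> * complex_of_real l"
  let ?M = "mat ?z - (A + B ** F)"
  have orth: "hinner (?M *v x) v = 0" for x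
  proof -
    have "(- A) *v v = - (A *v v)"
      by (simp add: vec_eq_iff matrix_vector_mult_def sum_negf)
    \<comment> \<open>Two signs cancel: one from skew-Hermitian \<open>A\<close>, one from
      conjugating the imaginary eigenvalue in the second argument of \<open>hinner\<close>. Hence
      \<open>v\<close> is also a left eigenvector for \<open>?z\<close>.\<close>
    then have "hinner (A *v x) v = - hinner x (A *v v)"
      using A by (simp add: hinner_adjoint skew_hermitian_def) (simp add: hinner_def sum_negf)
    also have "\<dots> = ?z * hinner x v"
      by (simp add: v hinner_def sum_distrib_left mult_ac sum_negf)
    finally have "hinner (A *v x) v = ?z * hinner x v" .
    moreover have "hinner ((B ** F) *v x) v = 0"
      by (simp add: matrix_vector_mul_assoc[symmetric] hinner_adjoint Bv) (simp add: hinner_def)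
    ultimately show ?thesis
      by (simp add: matrix_vector_mult_diff_rdistrib matrix_vector_mult_add_rdistrib mat_mult_vec
          hinner_diff_left hinner_add_left hinner_scale_left)
  qed
  have "\<exists>x. x \<noteq> 0 \<and> ?M *v x = 0"
  proof (rule ccontr)
    assume "\<not> (\<exists>x. x \<noteq> 0 \<and> ?M *v x = 0)"
    then obtain R where "R ** ?M = mat 1"
      using matrix_left_invertible_ker[of ?M] by blast
    then have "?M ** R = mat 1"
      using matrix_left_right_inverse by blast
    then have "?M *v (R *v v) = v"
      by (simp add: matrix_vector_mul_assoc)
    then have "hinner v v = 0" using orth[of "R *v v"] by simp
    then show False using v(2) by (simp add: hinner_self)
  qed
  then have "?z \<in> spectrum (A + B ** F)"
    by (auto simp: spectrum_def matrix_vector_mult_diff_rdistrib mat_mult_vec)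
  from F[OF this] show False by simp
qed

section \<open>Counting zeros with Rouche's theorem\<close>

lemma holomorphic_on_det:
  fixes M :: "complex \<Rightarrow> complex ^ 'n ^ 'n"
  assumes "\<And>i j. (\<lambda>z. M z $ i $ j) holomorphic_on S"
  shows "(\<lambda>z. det (M z)) holomorphic_on S"
  unfolding det_def using assms by (intro holomorphic_intros)

text \<open>The quadratic vanishes at \<open>c\<close> and at \<open>c + 2 * \<beta>\<close>, so at
  distance \<open>\<rho>\<close> from \<open>c\<close> its modulus is at least
  \<open>\<rho> * (2 * \<beta> - \<rho>)\<close>, which increases for \<open>\<rho>\<close> up to
  \<open>\<beta>\<close>. Covering the whole annulus, and not just the circle of radius
  \<open>r\<close>, also allows zeros outside the small disk to be excluded.\<close>

lemma norm_square_minus_ge: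
  fixes a z :: complex
  assumes "0 < r" "r \<le> dist c z" "dist c z < \<beta>" and c: "c = a - of_real \<beta>"
  shows "r * (2 * \<beta> - r) \<le> cmod ((z - a)\<^sup>2 - of_real (\<beta>\<^sup>2))"
proof -
  define \<rho> where "\<rho> = dist c z"
  have eq: "(z - a)\<^sup>2 - of_real (\<beta>\<^sup>2) = (z - c) * ((z - c) - of_real (2 * \<beta>))"
    by (simp add: c power2_eq_square algebra_simps)
  have "0 \<le> (\<rho> - r) * (2 * \<beta> - (\<rho> + r))"
    using assms by (intro mult_nonneg_nonneg) (auto simp: \<rho>_def)
  then have "r * (2 * \<beta> - r) \<le> \<rho> * (2 * \<beta> - \<rho>)"
    by (simp add: algebra_simps)
  also have "\<dots> \<le> cmod (z - c) * cmod ((z - c) - of_real (2 * \<beta>))"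
  proof (rule mult_mono)
    have "2 * \<beta> - cmod (z - c) \<le> cmod ((z - c) - of_real (2 * \<beta>))"
      using norm_triangle_ineq2[of "complex_of_real (2 * \<beta>)" "z - c"] assms
      by (simp add: norm_minus_commute del: of_real_mult)
    then show "2 * \<beta> - \<rho> \<le> cmod ((z - c) - of_real (2 * \<beta>))"
      by (simp add: \<rho>_def dist_norm norm_minus_commute)
  qed (use assms in \<open>auto simp: \<rho>_def dist_norm norm_minus_commute\<close>)
  finally show ?thesis by (simp only: eq norm_mult)
qed

text \<open>Rouche's theorem is applied to \<open>F\<close> and the quadratic on the circle of
  radius \<open>r\<close>, inside the larger disk of radius \<open>\<beta>\<close>. That disk
  contains only the zero \<open>c\<close> of the quadratic. The zero-free factor \<open>u\<close>
  transfers the count from \<open>F\<close> to \<open>D\<close> without changing orders.\<close>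

lemma sum_zorder_perturbed_square:
  fixes F u :: "complex \<Rightarrow> complex"
  assumes r: "0 < r" "r < \<beta>" and c: "c = a - of_real \<beta>"
    and F: "F holomorphic_on ball c \<beta>"
    and bound: "\<And>z. z \<in> ball c \<beta> \<Longrightarrow> cmod (F z - ((z - a)\<^sup>2 - of_real (\<beta>\<^sup>2))) < r * (2 * \<beta> - r)"
    and u: "u holomorphic_on ball c \<beta>" "\<And>z. z \<in> ball c \<beta> \<Longrightarrow> u z \<noteq> 0"
    and D: "\<And>z. z \<in> ball c \<beta> \<Longrightarrow> D z = F z * u z"
  shows "(\<Sum>z \<in> {z \<in> ball c r. D z = 0}. zorder D z) = 1"
proof -
  let ?q = "\<lambda>z. (z - a)\<^sup>2 - of_real (\<beta>\<^sup>2) :: complex"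
  define Z where "Z = {z \<in> ball c \<beta>. F z = 0}"
  \<comment> \<open>Rouche's theorem sums over all zeros in the large disk; this confines those of
    \<open>F\<close> to the small one, where the winding number is 1.\<close>
  have nz: "F z \<noteq> 0" if "z \<in> ball c \<beta>" "r \<le> dist c z" for z
    using bound[OF that(1)] norm_square_minus_ge[OF r(1) that(2) _ c] that
    by (auto simp: norm_minus_commute)
  then have Z: "Z = {z \<in> ball c r. F z = 0}"
    using r by (force simp: Z_def)
  have Z_D: "{z \<in> ball c r. D z = 0} = Z"
    unfolding Z using r D u(2) by (auto simp: mult_eq_0_iff subset_eq)
  have finZ: "finite Z"
  proof -
    have "finite {z \<in> cball c r. F z = 0}"
    \<comment> \<open>Zeros on a compact set are finite in number only for nonconstant
      \<open>F\<close>. A constant \<open>F\<close> has its value at \<open>p\<close> on the circle,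
      which is nonzero by \<open>nz\<close>.\<close>
    proof (cases "F constant_on ball c \<beta>")
      case True
      define p where "p = c + of_real r"
      have p: "p \<in> ball c \<beta>" "r \<le> dist c p"
        using r by (auto simp: p_def dist_norm)
      have "F z \<noteq> 0" if "z \<in> cball c r" for z
        using True nz[OF p] that r p(1) unfolding constant_on_def by (metis mem_ball mem_cball le_less_trans)
      then have "{z \<in> cball c r. F z = 0} = {}" by blast
      then show ?thesis by (simp only: finite.emptyI)
    next
      case False
      then show ?thesis
        using F r by (intro holomorphic_compact_finite_zeros[of F "ball c \<beta>"]) auto
    qed
    then show ?thesis
      by (rule rev_finite_subset) (auto simp: Z)
  qed
  have zeros_q: "{z \<in> ball c \<beta>. ?q z = 0} = {c}"
  proof -
    have "?q z = (z - c) * (z - (c + of_real (2 * \<beta>)))" for z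
      by (simp add: c power2_eq_square algebra_simps)
    moreover have "c + of_real (2 * \<beta>) \<notin> ball c \<beta>"
      using r by (simp add: dist_norm)
    ultimately show ?thesis using r by auto
  qed
  have zq: "zorder ?q c = 1"
  proof (rule zorder_eqI[of UNIV _ "\<lambda>z. z - (c + of_real (2 * \<beta>))"])
    show "?q w = (w - (c + of_real (2 * \<beta>))) * (w - c) powi 1" for w
      by (simp add: c power2_eq_square algebra_simps)
  qed (use r in \<open>auto intro: holomorphic_intros\<close>)
  let ?\<gamma> = "circlepath c r"
  have "(\<Sum>z\<in>Z. winding_number ?\<gamma> z * zorder F z) = winding_number ?\<gamma> c * zorder ?q c"
  proof -
    have out: "winding_number ?\<gamma> z = 0" if "z \<notin> ball c \<beta>" for z
      using that r by (intro winding_number_zero_outside[of _ "cball c r"]) auto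
    have holq: "?q holomorphic_on ball c \<beta>" and holr: "(\<lambda>z. F z - ?q z) holomorphic_on ball c \<beta>"
      using F by (auto intro!: holomorphic_intros)
    have sub: "sphere c r \<subseteq> ball c \<beta>" using r by auto
    have "cmod (F z - ?q z) < cmod (?q z)" if "z \<in> sphere c r" for z
      using bound[of z] norm_square_minus_ge[OF r(1) _ _ c, of z] that r by auto
    then show ?thesis
      using r Rouche_theorem[of "ball c \<beta>" ?q "\<lambda>z. F z - ?q z" ?\<gamma>]
        holq holr sub finZ zeros_q out
      by (simp add: Z_def)
  qed
  moreover have "winding_number ?\<gamma> z = 1" if "z \<in> ball c r" for z
    using that r by (intro winding_number_circlepath) (auto simp: dist_norm norm_minus_commute)
  ultimately have "(\<Sum>z\<in>Z. complex_of_int (zorder F z)) = 1"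
    using zq r by (simp add: Z)
  then have "(\<Sum>z\<in>Z. zorder F z) = 1"
    by (metis of_int_eq_1_iff of_int_sum)
  moreover have "zorder D z = zorder F z" if "z \<in> Z" for z
  proof -
    have z: "z \<in> ball c \<beta>" using that by (simp add: Z_def)
    have ev: "eventually (\<lambda>w. w \<in> ball c \<beta>) (at z)"
      using z by (intro eventually_at_in_open') auto
    have "\<not> z islimpt Z" using finZ by (simp add: islimpt_finite)
    then have "eventually (\<lambda>w. w \<notin> Z) (at z)" by (simp add: islimpt_iff_eventually)
    \<comment> \<open>Additivity of \<open>zorder\<close> requires the product to be nonzero on a
      punctured neighbourhood; finiteness of \<open>Z\<close> provides this.\<close>
    with ev have F0: "eventually (\<lambda>w. F w \<noteq> 0) (at z)"
      by eventually_elim (simp add: Z_def)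
    have u0: "eventually (\<lambda>w. F w * u w \<noteq> 0) (at z)"
      using F0 ev by eventually_elim (simp add: u(2))
    have an: "F analytic_on {z}" "u analytic_on {z}"
      using z F u(1) open_ball by (auto simp: analytic_at)
    have "zorder D z = zorder (\<lambda>w. F w * u w) z"
      using ev by (intro zorder_cong) (auto elim!: eventually_mono simp: D)
    also have "\<dots> = zorder F z + zorder u z"
      by (rule zorder_times_analytic[OF an u0])
    also have "zorder u z = 0"
      using z u by (intro zorder_eq_0I an) auto
    finally show ?thesis by simp
  qed
  ultimately show ?thesis unfolding Z_D using sum.cong[of Z Z "zorder D" "zorder F"] by auto
qed

lemma holomorphic_on_det_rank_one_sum:
  fixes b :: "nat \<Rightarrow> complex ^ 'n"
  assumes "\<And>z j. z \<in> S \<Longrightarrow> j \<in> I \<Longrightarrow> z \<noteq> \<mu> j"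
  shows "(\<lambda>z. det (mat 1 - rank_one_sum I (\<lambda>j. inverse ((z - \<mu> j)\<^sup>2)) b)) holomorphic_on S"
  by (rule holomorphic_on_det)
    (use assms in \<open>auto simp: rank_one_sum_def intro!: holomorphic_intros\<close>)

section \<open>Localization of the zero\<close>

theorem theorem10:
  fixes A :: "complex ^ 'n ^ 'n" and B :: "complex ^ 'm ^ 'n"
    and lam :: "nat \<Rightarrow> real" and v :: "nat \<Rightarrow> complex ^ 'n" and k :: nat
  assumes "CARD('n) \<ge> 2" and "CARD('m) \<le> CARD('n)"
    and "skew_hermitian A"
    and "{x. B *v x = 0} = {0}"
    and "stabilizable A B"
    and "mono_on {1..CARD('n)} lam"
    and "orthonormal_basis v"
    and "\<And>j. j \<in> {1..CARD('n)} \<Longrightarrow> A *v v j = (\<i> * complex_of_real (lam j)) *s v j"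
    and "k \<in> {1..CARD('n)}"
    and "gap (CARD('n)) lam k > 0"
    and "(op_norm B)\<^sup>2 / (gap (CARD('n)) lam k)\<^sup>2 < (2 - sqrt 2)\<^sup>2 / 2"
  shows "Phi_zero_count A B
           (ball (- complex_of_real (norm (conj_transpose B *v v k)) + \<i> * complex_of_real (lam k))
                 (2 / (2 - sqrt 2)\<^sup>2 * ((op_norm B)\<^sup>2 / (gap (CARD('n)) lam k)\<^sup>2)
                    * norm (conj_transpose B *v v k))) = 1"
proof -
  let ?N = "{1..CARD('n)}"
  define \<beta> where "\<beta> = norm (conj_transpose B *v v k)"
  define \<delta> where "\<delta> = gap (CARD('n)) lam k"
  define s where "s = 2 - sqrt 2"
  define \<eta> where "\<eta> = (op_norm B)\<^sup>2 / \<delta>\<^sup>2 / s\<^sup>2"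
  define r where "r = 2 * \<eta> * \<beta>"
  define b where "b = (\<lambda>j. conj_transpose B *v v j)"
  define \<mu> where "\<mu> = (\<lambda>j. \<i> * complex_of_real (lam j))"
  define c where "c = \<mu> k - complex_of_real \<beta>"
  define E where "E = (\<lambda>z. rank_one_sum (?N - {k}) (\<lambda>j. inverse ((z - \<mu> j)\<^sup>2)) b)"
  define D where "D = (\<lambda>z. det (Phi A B z))"
  define h where "h = (\<lambda>z. det (mat 1 - E z))"
  note v = \<open>orthonormal_basis v\<close> and k = \<open>k \<in> ?N\<close>
  have A: "A *v v j = \<mu> j *s v j" if "j \<in> ?N" for j
    using assms(8)[OF that] by (simp add: \<mu>_def)
  have \<delta>: "0 < \<delta>" using assms(10) by (simp add: \<delta>_def)
  have gap: "\<delta> \<le> \<bar>lam j - lam k\<bar>" if "j \<in> ?N - {k}" for j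
    unfolding \<delta>_def gap_def using that by (intro Min_le) auto
  \<comment> \<open>The constant balances two demands: \<open>\<eta> < 1 / 2\<close>, which keeps
    \<open>r\<close> below \<open>\<beta>\<close>, and \<open>\<beta> < (1 - s) * \<delta>\<close>,
    which keeps the disk away from the other eigenvalues. The identity \<open>s_eq\<close> makes
    both follow from the same bound on \<open>op_norm B\<close>.\<close>
  have s: "0 < s" "s < 1" and s_eq: "s\<^sup>2 / 2 = (1 - s)\<^sup>2"
    using sqrt2_less_2 by (auto simp: s_def power2_eq_square field_simps real_less_rsqrt)
  have norm_vk: "norm (v k) = 1"
    using hinner_self[of "v k"] orthonormal_basis_hinner[OF v k k]
    by (metis of_real_eq_1_iff norm_ge_zero power2_eq_1_iff neg_0_le_iff_le not_one_le_zero)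
  have "v k \<noteq> 0" using norm_vk by auto
  then have "0 < \<beta>"
    using stabilizable_conj_transpose_eigenvector[OF assms(3,5) assms(8)[OF k]]
    by (simp add: \<beta>_def)
  have \<beta>_le: "\<beta> \<le> op_norm B"
    using norm_conj_transpose_le[of B "v k"] by (simp add: \<beta>_def norm_vk)
  have \<eta>: "0 < \<eta>" "\<eta> < 1 / 2"
  proof -
    show "0 < \<eta>" using \<open>0 < \<beta>\<close> \<beta>_le \<delta> s by (simp add: \<eta>_def)
    show "\<eta> < 1 / 2"
      using assms(11) \<open>0 < s\<close>
      by (simp only: \<eta>_def s_def[symmetric] \<delta>_def[symmetric] pos_divide_less_eq zero_less_power)
  qed
  have r: "0 < r" "r < \<beta>"
    using \<eta> \<open>0 < \<beta>\<close> by (auto simp: r_def)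
  have \<beta>_less: "\<beta> < (1 - s) * \<delta>"
  proof -
    have "\<beta>\<^sup>2 \<le> (op_norm B)\<^sup>2"
      using \<beta>_le \<open>0 < \<beta>\<close> by (intro power_mono) auto
    also have "\<dots> < s\<^sup>2 / 2 * \<delta>\<^sup>2"
      using assms(11) \<delta>
      by (simp only: s_def[symmetric] \<delta>_def[symmetric] pos_divide_less_eq zero_less_power)
    also have "\<dots> = ((1 - s) * \<delta>)\<^sup>2"
      by (simp only: s_eq power_mult_distrib)
    finally show ?thesis
      by (rule power_less_imp_less_base) (use s \<delta> in simp)
  qed
  \<comment> \<open>The eigenvalues are imaginary, so the imaginary part alone puts \<open>c\<close>
    at distance at least \<open>\<delta>\<close> from \<open>\<mu> j\<close>; moving by less than
    \<open>\<beta>\<close> leaves \<open>s * \<delta>\<close>.\<close>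
  have far: "s * \<delta> \<le> cmod (z - \<mu> j)" if z: "z \<in> ball c \<beta>" and j: "j \<in> ?N - {k}" for z j
  proof -
    have "\<delta> \<le> \<bar>Im (c - \<mu> j)\<bar>" using gap[OF j] by (simp add: c_def \<mu>_def)
    also have "\<dots> \<le> cmod (c - \<mu> j)" by (rule abs_Im_le_cmod)
    also have "\<dots> \<le> cmod (c - z) + cmod (z - \<mu> j)"
      using norm_triangle_ineq[of "c - z" "z - \<mu> j"] by simp
    finally show ?thesis
      using z \<beta>_less by (simp add: dist_norm algebra_simps)
  qed
  have notin: "z \<noteq> \<mu> j" if z: "z \<in> ball c \<beta>" and j: "j \<in> ?N" for z j
  proof (cases "j = k")
    \<comment> \<open>The eigenvalue \<open>\<mu> k\<close> itself lies at distance exactly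
      \<open>\<beta>\<close> from \<open>c\<close>, on the boundary of the open ball.\<close>
    case True
    then show ?thesis using z \<open>0 < \<beta>\<close> by (auto simp: c_def dist_norm)
  next
    case False
    have "0 < s * \<delta>" using s \<delta> by simp
    also have "\<dots> \<le> cmod (z - \<mu> j)" using far[OF z] j False by blast
    finally show ?thesis by auto
  qed
  have bound_E: "norm (E z *v x) \<le> \<eta> * norm x" if z: "z \<in> ball c \<beta>" for z x
  proof -
    have "cmod (inverse ((z - \<mu> j)\<^sup>2)) \<le> inverse ((s * \<delta>)\<^sup>2)" if "j \<in> ?N - {k}" for j
      unfolding norm_inverse norm_power using far[OF z that] s \<delta>
      by (intro le_imp_inverse_le power_mono) auto
    then have "norm (E z *v x) \<le> inverse ((s * \<delta>)\<^sup>2) * (op_norm B)\<^sup>2 * norm x"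
      unfolding E_def b_def by (intro norm_rank_one_sum_mult_le[OF v]) auto
    also have "inverse ((s * \<delta>)\<^sup>2) * (op_norm B)\<^sup>2 = \<eta>"
      by (simp add: \<eta>_def divide_inverse power_mult_distrib mult_ac)
    finally show ?thesis .
  qed
  have h_nz: "h z \<noteq> 0" if "z \<in> ball c \<beta>" for z
    unfolding h_def using bound_E[OF that] \<eta> by (intro one_minus_contraction(1)[of _ \<eta>]) auto
  have h_holo: "h holomorphic_on ball c \<beta>"
    unfolding h_def E_def using notin by (intro holomorphic_on_det_rank_one_sum) auto
  \<comment> \<open>\<open>Phi\<close> is defined through \<open>matrix_inv\<close>, so holomorphy
    is read off from the explicit sum that agrees with it on the disk.\<close>
  have D_holo: "D holomorphic_on ball c \<beta>"
  proof (rule holomorphic_transform)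
    show "(\<lambda>z. det (mat 1 - rank_one_sum ?N (\<lambda>j. inverse ((z - \<mu> j)\<^sup>2)) b)) holomorphic_on ball c \<beta>"
      using notin by (intro holomorphic_on_det_rank_one_sum) auto
    show "det (mat 1 - rank_one_sum ?N (\<lambda>j. inverse ((z - \<mu> j)\<^sup>2)) b) = D z"
      if "z \<in> ball c \<beta>" for z
      unfolding D_def b_def using Phi_rank_one_sum[OF v A notin[OF that]] by (rule arg_cong[OF sym])
  qed
  \<comment> \<open>Defining \<open>?F\<close> as a quotient makes its holomorphy immediate. The
    vector \<open>x\<close> below is chosen separately for each \<open>z\<close>, so its dependence
    on \<open>z\<close> never has to be studied.\<close>
  let ?F = "\<lambda>z. (z - \<mu> k)\<^sup>2 * D z / h z"
  have bound_F: "cmod (?F z - ((z - \<mu> k)\<^sup>2 - of_real (\<beta>\<^sup>2))) < r * (2 * \<beta> - r)"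
    if z: "z \<in> ball c \<beta>" for z
  proof -
    obtain x where x: "(mat 1 - E z) *v x = b k"
      and le: "cmod (hinner x (b k) - of_real ((norm (b k))\<^sup>2)) \<le> \<eta> / (1 - \<eta>) * (norm (b k))\<^sup>2"
      using one_minus_contraction(2)[of "E z" \<eta> "b k"] bound_E[OF z] \<eta> by auto
    have "(z - \<mu> k)\<^sup>2 * D z = h z * ((z - \<mu> k)\<^sup>2 - hinner x (b k))"
      unfolding D_def h_def b_def
      by (rule det_Phi_factor[OF v A notin[OF z] k]) (use x in \<open>simp_all add: E_def b_def\<close>)
    then have "?F z = (z - \<mu> k)\<^sup>2 - hinner x (b k)"
      using h_nz[OF z] by (simp add: field_simps)
    then have "cmod (?F z - ((z - \<mu> k)\<^sup>2 - of_real (\<beta>\<^sup>2))) = cmod (hinner x (b k) - of_real (\<beta>\<^sup>2))"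
      by (simp add: norm_minus_commute)
    also have "\<dots> \<le> \<eta> / (1 - \<eta>) * \<beta>\<^sup>2"
      using le by (simp add: b_def \<beta>_def)
    \<comment> \<open>After division by \<open>\<eta>\<close> this says that the square of
      \<open>1 - \<eta>\<close> exceeds 1/4, which is where \<open>\<eta> < 1 / 2\<close> is
      used.\<close>
    also have "\<dots> < (4 * \<eta> * (1 - \<eta>)) * \<beta>\<^sup>2"
    proof (rule mult_strict_right_mono)
      have "1 / 2 < 1 - \<eta>" using \<eta> by simp
      then have "(1 / 2) * (1 / 2) < (1 - \<eta>) * (1 - \<eta>)"
        by (intro mult_strict_mono) auto
      then have "\<eta> * 1 < \<eta> * (4 * ((1 - \<eta>) * (1 - \<eta>)))"
        using \<eta> by (intro mult_strict_left_mono) auto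
      then show "\<eta> / (1 - \<eta>) < 4 * \<eta> * (1 - \<eta>)"
        using \<eta> by (simp add: pos_divide_less_eq mult_ac)
    qed (use \<open>0 < \<beta>\<close> in auto)
    also have "\<dots> = r * (2 * \<beta> - r)"
      by (simp add: r_def power2_eq_square algebra_simps)
    finally show ?thesis .
  qed
  have "(\<Sum>z \<in> {z \<in> ball c r. D z = 0}. zorder D z) = 1"
  proof (rule sum_zorder_perturbed_square[OF r c_def _ bound_F])
    show "?F holomorphic_on ball c \<beta>"
      using D_holo h_holo h_nz by (intro holomorphic_intros) auto
    show "(\<lambda>z. h z / (z - \<mu> k)\<^sup>2) holomorphic_on ball c \<beta>"
      using h_holo notin[OF _ k] by (intro holomorphic_intros) auto
    show "h z / (z - \<mu> k)\<^sup>2 \<noteq> 0" "D z = ?F z * (h z / (z - \<mu> k)\<^sup>2)" if "z \<in> ball c \<beta>" for z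
      using h_nz[OF that] notin[OF that k] by simp_all
  qed
  \<comment> \<open>\<open>Phi_zeros\<close> leaves out the spectrum; the disk contains no
    eigenvalue, so no zero of the determinant there is discarded.\<close>
  moreover have "Phi_zeros A B \<inter> ball c r = {z \<in> ball c r. D z = 0}"
  proof -
    have "z \<notin> spectrum A" if "z \<in> ball c r" for z
    proof -
      have "z \<in> ball c \<beta>" using that r by simp
      then show ?thesis using spectrum_subset_eigenvalues[OF v A] notin by blast
    qed
    then show ?thesis by (auto simp: Phi_zeros_def D_def)
  qed
  moreover have "- complex_of_real (norm (conj_transpose B *v v k)) + \<i> * complex_of_real (lam k) = c"
    by (simp add: c_def \<mu>_def \<beta>_def)
  moreover have "2 / (2 - sqrt 2)\<^sup>2 * ((op_norm B)\<^sup>2 / (gap (CARD('n)) lam k)\<^sup>2)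
      * norm (conj_transpose B *v v k) = r"
    by (simp add: r_def \<eta>_def s_def \<delta>_def \<beta>_def)
  ultimately show ?thesis
    by (simp only: Phi_zero_count_def D_def)
qed

end
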